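(* For all integers $a\geqslant1$, $b\geqslant0$, with $k=2a+2b+1$, $$\begin{aligned}\sigma(\underbrace{2,\ldots,2}_a,1,\underbrace{2,\ldots,2}_b)&=\sum_{r=a}^{a+b}\binom{2r}{2a-1}\frac{(\pi/3)^{k-1-2r}}{(k-1-2r)!}(-1)^r(1-3^{-2r})\zeta(2r+1)\\&+\sum_{r=a}^{a+b}\binom{2r-1}{2a-1}\frac{(\pi/3)^{k-2r}}{(k-2r)!}(-1)^r\sqrt3\,L(2r,\chi)\\&-\sum_{r=b+1}^{a+b}\binom{2r}{2b+1}\frac{(\pi/3)^{k-1-2r}}{(k-1-2r)!}(-1)^r\,2(1-2^{-2r})\zeta(2r+1).\end{aligned}$$
   Context: For a composition $(a_1,\ldots,a_r)$ of positive integers, $\sigma(a_1,\ldots,a_r)=\sum_{n_1>\cdots>n_r>0}\binom{2n_1}{n_1}^{-1}n_1^{-a_1}\cdots n_r^{-a_r}$. $\zeta(s)$ is the Riemann zeta function, $\chi$ is the non-principal Dirichlet character modulo $3$, and $L(s,\chi)=\sum_{n\geqslant1}\chi(n)n^{-s}$. *)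

theory Defs
  imports "HOL-Analysis.Analysis"
begin

definition decreasing_tuples :: "nat \<Rightarrow> nat list set" where
  "decreasing_tuples r = {ns. length ns = r \<and> sorted_wrt (>) ns \<and> (\<forall>n\<in>set ns. n > 0)}"

text \<open>Only meaningful for nonempty \<open>as\<close>, since \<open>hd ns\<close> is the largest index \<open>n\<^sub>1\<close>.\<close>

definition binomial_sigma :: "nat list \<Rightarrow> real" where
  "binomial_sigma as = (\<Sum>\<^sub>\<infinity>ns\<in>decreasing_tuples (length as).
      1 / real ((2 * hd ns) choose hd ns) * (\<Prod>i<length as. 1 / real (ns ! i) ^ (as ! i)))"

text \<open>The Dirichlet series of the Riemann zeta function, which represents it for \<open>s > 1\<close> only.\<close>

definition zeta :: "real \<Rightarrow> real" where
  "zeta s = (\<Sum>n. 1 / real (Suc n) powr s)"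

definition L_series :: "real \<Rightarrow> (nat \<Rightarrow> real) \<Rightarrow> real" where
  "L_series s \<psi> = (\<Sum>n. \<psi> (Suc n) / real (Suc n) powr s)"

definition chi3 :: "nat \<Rightarrow> real" where
  "chi3 n = (if n mod 3 = 1 then 1 else if n mod 3 = 2 then -1 else 0)"

definition dirichlet_character :: "nat \<Rightarrow> (nat \<Rightarrow> complex) \<Rightarrow> bool" where
  "dirichlet_character m \<psi> \<longleftrightarrow>
     (\<forall>n. \<psi> (n + m) = \<psi> n) \<and> (\<forall>n k. \<psi> (n * k) = \<psi> n * \<psi> k) \<and>
     (\<forall>n. \<psi> n \<noteq> 0 \<longleftrightarrow> coprime n m)"

definition principal_character :: "nat \<Rightarrow> nat \<Rightarrow> complex" where
  "principal_character m n = (if coprime n m then 1 else 0)"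

lemma coprime_3_iff: "coprime n (3::nat) \<longleftrightarrow> n mod 3 \<noteq> 0"
proof -
  have r: "n mod 3 = 0 \<or> n mod 3 = 1 \<or> n mod 3 = 2" by linarith
  have g: "gcd n 3 = gcd 3 (n mod 3)" by (metis gcd.commute gcd_red_nat)
  have "gcd (3::nat) 0 = 3" "gcd (3::nat) 1 = 1" "gcd (3::nat) 2 = 1"
    by (simp_all add: gcd_non_0_nat)
  hence "gcd n 3 = (if n mod 3 = 0 then 3 else 1)" using r g by (elim disjE) (simp_all del: gcd_mod_right gcd_mod_left)
  thus ?thesis by (simp add: coprime_iff_gcd_eq_1 split: if_splits)
qed

lemma mult_mod_3: "(n * k) mod 3 = ((n mod 3) * (k mod 3)) mod (3::nat)"
  by (simp add: mod_mult_eq)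

lemma chi3_unique:
  "dirichlet_character 3 \<psi> \<and> \<psi> \<noteq> principal_character 3 \<longleftrightarrow> \<psi> = (\<lambda>n. complex_of_real (chi3 n))"
proof
  assume asm: "dirichlet_character 3 \<psi> \<and> \<psi> \<noteq> principal_character 3"
  hence per: "\<And>n. \<psi> (n + 3) = \<psi> n" and mult: "\<And>n k. \<psi> (n * k) = \<psi> n * \<psi> k"
    and nz: "\<And>n. \<psi> n \<noteq> 0 \<longleftrightarrow> n mod 3 \<noteq> 0"
    unfolding dirichlet_character_def coprime_3_iff by blast+
  have per': "\<psi> (n + 3 * q) = \<psi> n" for n q
  proof (induction q)
    case (Suc q)
    have "\<psi> (n + 3 * Suc q) = \<psi> (n + 3 * q + 3)" by (simp add: algebra_simps)
    thus ?case using per Suc by simp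
  qed simp
  have md: "\<psi> n = \<psi> (n mod 3)" for n
    using per'[of "n mod 3" "n div 3"] by simp
  have c0: "\<psi> 0 = 0" using nz[of 0] by simp
  have c1: "\<psi> 1 = 1" using mult[of 1 1] nz[of 1] by simp
  have "\<psi> 2 * \<psi> 2 = 1" using mult[of 2 2] per[of 1] c1 by simp
  hence c2: "\<psi> 2 = 1 \<or> \<psi> 2 = -1" by (simp add: square_eq_1_iff)
  have r: "n mod 3 = 0 \<or> n mod 3 = 1 \<or> n mod 3 = 2" for n :: nat by linarith
  have "\<psi> 2 \<noteq> 1"
  proof
    assume "\<psi> 2 = 1"
    hence "\<psi> n = principal_character 3 n" for n
      using md[of n] r[of n] c0 c1 by (auto simp: principal_character_def coprime_3_iff)
    thus False using asm by blast
  qed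
  hence "\<psi> 2 = -1" using c2 by blast
  hence "\<psi> n = complex_of_real (chi3 n)" for n
    using md[of n] r[of n] c0 c1 by (auto simp: chi3_def)
  thus "\<psi> = (\<lambda>n. complex_of_real (chi3 n))" by blast
next
  assume eq: "\<psi> = (\<lambda>n. complex_of_real (chi3 n))"
  have r: "n mod 3 = 0 \<or> n mod 3 = 1 \<or> n mod 3 = 2" for n :: nat by linarith
  have "chi3 (n * k) = chi3 n * chi3 k" for n k
    using r[of n] r[of k] mult_mod_3[of n k] by (auto simp: chi3_def)
  moreover have "chi3 n \<noteq> 0 \<longleftrightarrow> coprime n 3" for n
    using r[of n] by (auto simp: chi3_def coprime_3_iff)
  moreover have "\<psi> 2 \<noteq> principal_character 3 2"
    by (simp add: eq chi3_def principal_character_def coprime_3_iff)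
  hence "\<psi> \<noteq> principal_character 3" by metis
  moreover have "chi3 (n + 3) = chi3 n" for n by (simp add: chi3_def)
  ultimately show "dirichlet_character 3 \<psi> \<and> \<psi> \<noteq> principal_character 3"
    unfolding dirichlet_character_def eq by simp
qed

end

theory Submission
  imports Defs "HOL-Computational_Algebra.Polynomial"
begin

text \<open>
  Put \<open>f\<^sub>s(t) = \<Sum> (2 sin (t/2))\<^bsup>2n\<^sub>1\<^esup> / (binom(2n\<^sub>1, n\<^sub>1) n\<^sub>1\<^bsup>s\<^sub>1\<^esup> \<dots> n\<^sub>r\<^bsup>s\<^sub>r\<^esup>)\<close>, summed over decreasing
  tuples, so that \<open>\<sigma>(s) = f\<^sub>s(\<pi>/3)\<close>. Removing a leading 2 from \<open>s\<close> amounts to differentiating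
  twice, and replacing a leading 2 by 1 amounts to applying \<open>tan(t/2) d/dt\<close>. Since \<open>f = 1\<close> for the
  empty composition, Taylor's formula with integral remainder gives
  \<open>\<sigma>(2\<^sup>a, 1, 2\<^sup>b) = \<integral> (\<pi>/3 - v)\<^bsup>2a-1\<^esup>/(2a-1)! v\<^bsup>2b+1\<^esup>/(2b+1)! tan(v/2) dv\<close> over \<open>[0, \<pi>/3]\<close>.
  Now expand \<open>tan(v/2)\<close> as \<open>2 \<Sum> (-1)\<^bsup>n-1\<^esup> sin(nv)\<close>; the series does not converge, but its partial sums
  have an explicit oscillating error whose contribution vanishes by the Riemann-Lebesgue lemma.
  Integrating the polynomial against \<open>sin(nv)\<close> by parts leaves boundary terms at \<open>0\<close> and \<open>\<pi>/3\<close>,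
  which sum to the zeta and L-values.
\<close>

section \<open>Series over the largest index\<close>

text \<open>The inner sum over tuples whose largest index is \<open>n\<close>. Giving the empty
  composition the head 0 lets one recursion cover the last index too. Every nonempty composition
  gets value 0 at \<open>n = 0\<close>, so only positive indices contribute.\<close>

fun mhs :: "nat list \<Rightarrow> nat \<Rightarrow> real" where
  "mhs [] n = (if n = 0 then 1 else 0)"
| "mhs (a # as) n = (\<Sum>m<n. mhs as m) / real n ^ a"

text \<open>The empty list is treated as if its head were 0.\<close>

definition tuples_with_head :: "nat \<Rightarrow> nat \<Rightarrow> nat list set" where
  "tuples_with_head r n = {ns \<in> decreasing_tuples r. hd (ns @ [0]) = n}"

lemma mhs_nonneg: "mhs as n \<ge> 0"
  by (induction as arbitrary: n) (auto intro!: divide_nonneg_nonneg sum_nonneg)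

lemma mhs_le_1:
  assumes "\<forall>a\<in>set as. a \<ge> 1"
  shows "mhs as n \<le> 1"
  using assms
proof (induction as arbitrary: n)
  case (Cons a as)
  show ?case
  proof (cases "n = 0")
    case False
    have "(\<Sum>m<n. mhs as m) \<le> (\<Sum>m<n. 1)"
      by (rule sum_mono) (use Cons in auto)
    also have "\<dots> \<le> real n ^ a"
      using False Cons.prems self_le_power[of "real n" a] by simp
    finally show ?thesis using False by (simp add: field_simps)
  qed auto
qed auto

lemma tuples_with_head_0: "tuples_with_head 0 n = (if n = 0 then {[]} else {})"
  by (auto simp: tuples_with_head_def decreasing_tuples_def)

text \<open>Removing the head leaves a tuple whose own head \<open>m\<close> is smaller. For
  \<open>r = 0\<close> the convention that the empty tuple has head 0 turns \<open>m < n\<close>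
  into positivity of \<open>n\<close>.\<close>

lemma tuples_with_head_Suc:
  "tuples_with_head (Suc r) n = Cons n ` (\<Union>m<n. tuples_with_head r m)"
proof (intro equalityI subsetI)
  fix ns assume "ns \<in> tuples_with_head (Suc r) n"
  then obtain xs where ns: "ns = n # xs" and xs: "length xs = r" "sorted_wrt (>) xs"
    "\<forall>x\<in>set xs. x > 0" "\<forall>x\<in>set xs. x < n" "n > 0"
    by (cases ns) (auto simp: tuples_with_head_def decreasing_tuples_def)
  have "hd (xs @ [0]) < n" using xs by (cases xs) auto
  moreover have "xs \<in> tuples_with_head r (hd (xs @ [0]))"
    using xs by (auto simp: tuples_with_head_def decreasing_tuples_def)
  ultimately show "ns \<in> Cons n ` (\<Union>m<n. tuples_with_head r m)" using ns by blast
next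
  fix ns assume "ns \<in> Cons n ` (\<Union>m<n. tuples_with_head r m)"
  then obtain xs m where ns: "ns = n # xs" and m: "m < n" "xs \<in> tuples_with_head r m" by blast
  have xs: "length xs = r" "sorted_wrt (>) xs" "\<forall>x\<in>set xs. x > 0" "hd (xs @ [0]) < n"
    using m by (auto simp: tuples_with_head_def decreasing_tuples_def)
  have "\<forall>x\<in>set xs. x < n" using xs by (cases xs) (auto intro: less_trans)
  then show "ns \<in> tuples_with_head (Suc r) n"
    using xs m by (auto simp: ns tuples_with_head_def decreasing_tuples_def)
qed

lemma finite_tuples_with_head: "finite (tuples_with_head r n)"
  by (induction r arbitrary: n) (auto simp: tuples_with_head_0 tuples_with_head_Suc)

lemma sum_tuples_with_head:
  "(\<Sum>ns\<in>tuples_with_head (length as) n. \<Prod>i<length as. 1 / real (ns ! i) ^ (as ! i)) = mhs as n"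
proof (induction as arbitrary: n)
  case (Cons a as)
  let ?P = "\<lambda>ns. \<Prod>i<length as. 1 / real (ns ! i) ^ (as ! i)"
  have "(\<Sum>ns\<in>tuples_with_head (length (a # as)) n.
          \<Prod>i<length (a # as). 1 / real (ns ! i) ^ ((a # as) ! i)) =
        (\<Sum>ns\<in>(\<Union>m<n. tuples_with_head (length as) m). 1 / real n ^ a * ?P ns)"
    by (simp add: tuples_with_head_Suc sum.reindex prod.lessThan_Suc_shift del: prod.lessThan_Suc)
  also have "\<dots> = (\<Sum>m<n. \<Sum>ns\<in>tuples_with_head (length as) m. 1 / real n ^ a * ?P ns)"
    by (rule sum.UNION_disjoint) (auto simp: finite_tuples_with_head, auto simp: tuples_with_head_def)
  also have "\<dots> = (\<Sum>m<n. 1 / real n ^ a * mhs as m)"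
    unfolding sum_distrib_left[symmetric] Cons.IH ..
  also have "\<dots> = mhs (a # as) n"
    by (simp add: sum_divide_distrib)
  finally show ?case .
qed (auto simp: tuples_with_head_0)

text \<open>The factor \<open>4 ^ n\<close> is chosen so that powers of
  \<open>(sin (t / 2))\<^sup>2\<close> produce \<open>(2 sin (t / 2)) ^ (2 * n)\<close> over the
  central binomial coefficient.\<close>

definition central_weight :: "nat \<Rightarrow> real" where
  "central_weight n = 4 ^ n / real ((2 * n) choose n)"

lemma central_weight_0 [simp]: "central_weight 0 = 1"
  by (simp add: central_weight_def)

lemma central_weight_nonneg: "central_weight n \<ge> 0"
  by (simp add: central_weight_def)

text \<open>The ratio of consecutive central binomial coefficients is
  \<open>2 (2n + 1) / (n + 1)\<close>. This first-order recurrence is the source of the differential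
  equation below.\<close>

lemma central_weight_Suc:
  "real (2 * n + 1) * central_weight (Suc n) = 2 * real (n + 1) * central_weight n"
proof -
  define A B where "A = real ((2 * n) choose n)" and "B = real ((2 * Suc n) choose Suc n)"
  have 1: "Suc n * ((2 * Suc n) choose Suc n) = (2 * Suc n) * ((2 * n + 1) choose n)"
    using Suc_times_binomial_eq[of "2 * n + 1" n] by simp
  have 2: "Suc n * ((2 * n + 1) choose n) = (2 * n + 1) * ((2 * n) choose n)"
    using binomial_absorb_comp[of "2 * n + 1" n] by (simp add: Suc_diff_le)
  have "Suc n * (Suc n * ((2 * Suc n) choose Suc n)) = Suc n * (2 * (2 * n + 1) * ((2 * n) choose n))"
    using 1 2 by (metis (no_types, opaque_lifting) mult.assoc mult.commute)
  hence "Suc n * ((2 * Suc n) choose Suc n) = 2 * (2 * n + 1) * ((2 * n) choose n)"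
    by (meson Suc_mult_cancel1)
  hence "real (Suc n) * real ((2 * Suc n) choose Suc n) = 2 * real (2 * n + 1) * real ((2 * n) choose n)"
    by (metis of_nat_mult of_nat_numeral)
  hence "real (Suc n) * B = 2 * real (2 * n + 1) * A"
    by (simp only: A_def B_def)
  moreover have "A > 0" "B > 0"
    by (simp_all add: A_def B_def del: binomial_Suc_Suc)
  ultimately have "real (2 * n + 1) * (4 ^ Suc n / B) = 2 * real (n + 1) * (4 ^ n / A)"
    by (simp add: frac_eq_eq) (simp add: algebra_simps)
  thus ?thesis
    by (simp only: central_weight_def A_def B_def)
qed

text \<open>Consecutive weights have ratio \<open>(2n + 2) / (2n + 1)\<close>, at most 2. The crude
  bound gives convergence for \<open>\<bar>y\<bar> < 1 / 2\<close>, which contains the point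
  \<open>1 / 4\<close> of interest.\<close>

lemma central_weight_le: "central_weight n \<le> 2 ^ n"
proof (induction n)
  case (Suc n)
  have "real (2 * n + 1) * central_weight (Suc n) \<le> real (2 * n + 1) * (2 * central_weight n)"
    using central_weight_Suc[of n] mult_nonneg_nonneg[of "real n" "central_weight n"]
      central_weight_nonneg[of n] by (simp add: algebra_simps)
  hence "central_weight (Suc n) \<le> 2 * central_weight n"
    by (subst (asm) mult_le_cancel_left_pos) auto
  with Suc show ?case by simp
qed simp

definition sigma_coeff :: "nat list \<Rightarrow> nat \<Rightarrow> real" where
  "sigma_coeff as n = mhs as n * central_weight n"

lemma summable_sigma_coeff:
  fixes y :: real
  assumes "\<forall>a\<in>set as. a \<ge> 1" "norm y < 1 / 2"
  shows "summable (\<lambda>n. sigma_coeff as n * y ^ n)"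
proof (rule summable_comparison_test'[of "\<lambda>n. (2 * \<bar>y\<bar>) ^ n" 0])
  show "summable (\<lambda>n. (2 * \<bar>y\<bar>) ^ n)" using assms by (intro summable_geometric) auto
  fix n
  have "mhs as n * central_weight n \<le> 1 * 2 ^ n"
    using mhs_le_1[OF assms(1)] mhs_nonneg central_weight_le central_weight_nonneg
    by (intro mult_mono) auto
  thus "norm (sigma_coeff as n * y ^ n) \<le> (2 * \<bar>y\<bar>) ^ n"
    using mhs_nonneg[of as n] central_weight_nonneg[of n]
    by (auto simp: sigma_coeff_def abs_mult power_abs power_mult_distrib intro!: mult_right_mono)
qed

definition sigma_series :: "nat list \<Rightarrow> real \<Rightarrow> real" where
  "sigma_series as y = (\<Sum>n. sigma_coeff as n * y ^ n)"

text \<open>Tuples are grouped by their largest index. All terms are nonnegative, so the unordered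
  sum equals the iterated one: a finite sum for each head, then a series over heads.\<close>

lemma binomial_sigma_eq_series:
  assumes "\<forall>a\<in>set as. a \<ge> 1" "as \<noteq> []"
  shows "binomial_sigma as = sigma_series as (1 / 4)"
proof -
  let ?g = "\<lambda>ns. 1 / real ((2 * hd ns) choose hd ns) * (\<Prod>i<length as. 1 / real (ns ! i) ^ (as ! i))"
  let ?S = "Sigma UNIV (tuples_with_head (length as))"
  have sums: "(\<lambda>n. mhs as n / real ((2 * n) choose n)) sums sigma_series as (1 / 4)"
    using summable_sums[OF summable_sigma_coeff[OF assms(1), of "1 / 4"]]
    by (simp add: sigma_series_def sigma_coeff_def central_weight_def power_divide)
  have hd: "hd ns = n" if "ns \<in> tuples_with_head (length as) n" for ns n
    using that assms(2) by (cases ns) (auto simp: tuples_with_head_def decreasing_tuples_def)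
  have inner: "((\<lambda>ns. ?g ns) has_sum (mhs as n / real ((2 * n) choose n))) (tuples_with_head (length as) n)" for n
  proof (rule has_sum_finiteI[OF finite_tuples_with_head])
    have "(\<Sum>ns\<in>tuples_with_head (length as) n. ?g ns) = (\<Sum>ns\<in>tuples_with_head (length as) n.
            1 / real ((2 * n) choose n) * (\<Prod>i<length as. 1 / real (ns ! i) ^ (as ! i)))"
      by (intro sum.cong refl) (simp add: hd)
    also have "\<dots> = mhs as n / real ((2 * n) choose n)"
      unfolding sum_distrib_left[symmetric] sum_tuples_with_head by simp
    finally show "mhs as n / real ((2 * n) choose n) = sum ?g (tuples_with_head (length as) n)" ..
  qed
  have outer: "((\<lambda>n. mhs as n / real ((2 * n) choose n)) has_sum sigma_series as (1 / 4)) UNIV"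
    by (rule sums_nonneg_imp_has_sum[OF sums]) (simp add: mhs_nonneg)
  have "((\<lambda>z. ?g (snd z)) has_sum sigma_series as (1 / 4)) ?S"
  proof (rule has_sum_SigmaI[OF _ outer])
    show "(\<lambda>z. ?g (snd z)) summable_on ?S"
      by (rule summable_on_SigmaI[where g = "\<lambda>n. mhs as n / real ((2 * n) choose n)"])
        (use inner outer in \<open>auto simp: summable_on_def intro!: divide_nonneg_nonneg prod_nonneg\<close>)
  qed (use inner in simp)
  also have "?this \<longleftrightarrow> (?g has_sum sigma_series as (1 / 4)) (snd ` ?S)"
    by (subst has_sum_reindex) (auto simp: inj_on_def o_def tuples_with_head_def)
  also have "snd ` ?S = decreasing_tuples (length as)"
    by (force simp: tuples_with_head_def)
  finally show ?thesis
    unfolding binomial_sigma_def by (rule infsumI)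
qed

section \<open>Differential equations\<close>

lemma has_integral_real_derivative:
  fixes F f :: "real \<Rightarrow> real"
  assumes "a \<le> b" "\<And>x. x \<in> {a..b} \<Longrightarrow> (F has_field_derivative f x) (at x)"
  shows "(f has_integral (F b - F a)) {a..b}"
  using assms
  by (intro fundamental_theorem_of_calculus)
     (auto intro: has_field_derivative_at_within simp flip: has_real_derivative_iff_has_vector_derivative)

definition sigma_series_deriv :: "nat list \<Rightarrow> real \<Rightarrow> real" where
  "sigma_series_deriv as y = (\<Sum>n. diffs (sigma_coeff as) n * y ^ n)"

definition sigma_series_deriv2 :: "nat list \<Rightarrow> real \<Rightarrow> real" where
  "sigma_series_deriv2 as y = (\<Sum>n. diffs (diffs (sigma_coeff as)) n * y ^ n)"

text \<open>On coefficients, the operator \<open>y d/dy\<close> is multiplication by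
  \<open>n\<close>.\<close>

lemma sums_mult_diffs:
  fixes y :: real
  assumes "(\<lambda>n. diffs c n * y ^ n) sums s"
  shows "(\<lambda>n. real n * c n * y ^ n) sums (y * s)"
proof -
  have "(\<lambda>n. y * (diffs c n * y ^ n)) sums (y * s)"
    using assms by (rule sums_mult)
  hence "(\<lambda>n. real (Suc n) * c (Suc n) * y ^ Suc n) sums (y * s)"
    by (simp add: diffs_def mult_ac)
  thus ?thesis by (subst (asm) sums_Suc_iff) simp
qed

context
  fixes as :: "nat list" and y :: real
  assumes as: "\<forall>a\<in>set as. a \<ge> 1" and y: "norm y < 1 / 2"
begin

lemma sums_sigma_series_deriv: "(\<lambda>n. diffs (sigma_coeff as) n * y ^ n) sums sigma_series_deriv as y"
  unfolding sigma_series_deriv_def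
  by (rule summable_sums, rule termdiff_converges[OF y summable_sigma_coeff[OF as]])

lemma sums_sigma_series_deriv2:
  "(\<lambda>n. diffs (diffs (sigma_coeff as)) n * y ^ n) sums sigma_series_deriv2 as y"
  unfolding sigma_series_deriv2_def
  by (rule summable_sums, rule termdiff_converges[OF y], rule termdiff_converges[where K = "1 / 2"])
     (auto intro: summable_sigma_coeff[OF as])

lemma DERIV_sigma_series: "(sigma_series as has_field_derivative sigma_series_deriv as y) (at y)"
  unfolding sigma_series_def[abs_def] sigma_series_deriv_def
  by (rule termdiffs_strong'[OF summable_sigma_coeff[OF as] y])

lemma DERIV_sigma_series_deriv:
  "(sigma_series_deriv as has_field_derivative sigma_series_deriv2 as y) (at y)"
  unfolding sigma_series_deriv_def[abs_def] sigma_series_deriv2_def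
  by (rule termdiffs_strong'[OF _ y], rule termdiff_converges[where K = "1 / 2"])
     (auto intro: summable_sigma_coeff[OF as])

end

text \<open>Lowering the leading exponent from 2 to 1 multiplies the coefficient by
  \<open>n\<close>, hence is \<open>y d/dy\<close>.\<close>

lemma sigma_series_1_Cons:
  assumes "\<forall>a\<in>set as. a \<ge> 1" "norm y < 1 / 2"
  shows "sigma_series (1 # as) y = y * sigma_series_deriv (2 # as) y"
proof -
  have "(\<lambda>n. real n * sigma_coeff (2 # as) n * y ^ n) sums (y * sigma_series_deriv (2 # as) y)"
    using assms by (intro sums_mult_diffs sums_sigma_series_deriv) auto
  also have "(\<lambda>n. real n * sigma_coeff (2 # as) n * y ^ n) = (\<lambda>n. sigma_coeff (1 # as) n * y ^ n)"
    by (auto simp: sigma_coeff_def fun_eq_iff power2_eq_square)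
  finally show ?thesis by (simp add: sigma_series_def sums_iff)
qed

text \<open>Clearing the leading square leaves partial sums of \<open>mhs as\<close>, which grow by
  \<open>mhs as n\<close> from \<open>n\<close> to \<open>n + 1\<close>;
  \<open>central_weight_Suc\<close> aligns the two weights.\<close>

lemma sigma_coeff_2_recurrence:
  "real (n + 1) * real (2 * n + 1) * sigma_coeff (2 # as) (Suc n)
     - 2 * (real n)\<^sup>2 * sigma_coeff (2 # as) n = 2 * sigma_coeff as n"
proof -
  define U where "U = (\<lambda>n. \<Sum>m<n. mhs as m)"
  have "real (n + 1) * real (2 * n + 1) * sigma_coeff (2 # as) (Suc n)
      = U (Suc n) / real (n + 1) * (real (2 * n + 1) * central_weight (Suc n))"
    by (simp add: sigma_coeff_def U_def power2_eq_square)
  also have "\<dots> = 2 * U (Suc n) * central_weight n"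
    unfolding central_weight_Suc by (simp add: field_simps)
  also have "\<dots> = 2 * U n * central_weight n + 2 * sigma_coeff as n"
    by (simp add: U_def sigma_coeff_def algebra_simps)
  also have "2 * U n * central_weight n = 2 * (real n)\<^sup>2 * sigma_coeff (2 # as) n"
    by (cases "n = 0") (auto simp: sigma_coeff_def U_def)
  finally show ?thesis by simp
qed

text \<open>Comparison of coefficients with the preceding recurrence. The operator on the left is
  the second derivative in \<open>t\<close> when \<open>y = (sin (t / 2))\<^sup>2\<close>.\<close>

lemma sigma_series_ode:
  assumes "\<forall>a\<in>set as. a \<ge> 1" "norm y < 1 / 2"
  shows "y * (1 - y) * sigma_series_deriv2 (2 # as) y + (1 / 2 - y) * sigma_series_deriv (2 # as) y
       = sigma_series as y"
proof -
  let ?c = "sigma_coeff (2 # as)"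
  let ?d1 = "sigma_series_deriv (2 # as) y" and ?d2 = "sigma_series_deriv2 (2 # as) y"
  have pos: "\<forall>a\<in>set (2 # as). a \<ge> 1" using assms by auto
  have s1: "(\<lambda>n. diffs ?c n * y ^ n) sums ?d1"
    by (rule sums_sigma_series_deriv[OF pos assms(2)])
  have s2: "(\<lambda>n. diffs (diffs ?c) n * y ^ n) sums ?d2"
    by (rule sums_sigma_series_deriv2[OF pos assms(2)])
  have s3: "(\<lambda>n. real n * ?c n * y ^ n) sums (y * ?d1)"
    by (rule sums_mult_diffs[OF s1])
  have s4: "(\<lambda>n. real n * diffs ?c n * y ^ n) sums (y * ?d2)"
    by (rule sums_mult_diffs[OF s2])
  \<comment> \<open>The term with \<open>y\<^sup>2\<close> has coefficients
    \<open>n (n - 1) c n\<close>. It comes from \<open>s4\<close> by one more factor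
    \<open>y\<close>, with the index shifted and \<open>n\<close> written as
    \<open>Suc n - 1\<close>.\<close>
  have "(\<lambda>n. y * (real n * diffs ?c n * y ^ n)) sums (y * (y * ?d2))"
    using s4 by (rule sums_mult)
  hence "(\<lambda>n. (real (Suc n) - 1) * real (Suc n) * ?c (Suc n) * y ^ Suc n) sums (y * (y * ?d2))"
    by (simp add: diffs_def mult_ac)
  hence s5: "(\<lambda>n. (real n - 1) * real n * ?c n * y ^ n) sums (y * (y * ?d2))"
    by (subst (asm) sums_Suc_iff) simp
  have "(\<lambda>n. real n * diffs ?c n * y ^ n - (real n - 1) * real n * ?c n * y ^ n
            + (1 / 2 * (diffs ?c n * y ^ n) - real n * ?c n * y ^ n))
          sums (y * ?d2 - y * (y * ?d2) + (1 / 2 * ?d1 - y * ?d1))"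
    by (intro sums_add sums_diff sums_mult s1 s3 s4 s5)
  also have "(\<lambda>n. real n * diffs ?c n * y ^ n - (real n - 1) * real n * ?c n * y ^ n
            + (1 / 2 * (diffs ?c n * y ^ n) - real n * ?c n * y ^ n))
      = (\<lambda>n. (real (n + 1) * real (2 * n + 1) * ?c (Suc n) - 2 * (real n)\<^sup>2 * ?c n) / 2 * y ^ n)"
    by (auto simp: fun_eq_iff diffs_def field_simps power2_eq_square)
  also have "\<dots> = (\<lambda>n. sigma_coeff as n * y ^ n)"
    unfolding sigma_coeff_2_recurrence by simp
  finally have "sigma_series as y = y * ?d2 - y * (y * ?d2) + (1 / 2 * ?d1 - y * ?d1)"
    by (simp add: sigma_series_def sums_iff)
  thus ?thesis by (simp add: algebra_simps)
qed

section \<open>Passage to the angle \<open>t\<close>\<close>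

definition sigma_fun :: "nat list \<Rightarrow> real \<Rightarrow> real" where
  "sigma_fun as t = sigma_series as ((sin (t / 2))\<^sup>2)"

definition sigma_fun_deriv :: "nat list \<Rightarrow> real \<Rightarrow> real" where
  "sigma_fun_deriv as t = sigma_series_deriv as ((sin (t / 2))\<^sup>2) * (sin t / 2)"

text \<open>Since \<open>cos t = 1 - 2 y\<close>, the bound \<open>y < 1 / 2\<close> amounts to
  positivity of the cosine.\<close>

lemma sin_half_squared_less: "\<bar>t\<bar> < pi / 2 \<Longrightarrow> norm ((sin (t / 2))\<^sup>2) < (1 / 2 :: real)"
proof -
  assume "\<bar>t\<bar> < pi / 2"
  hence "cos t > 0" by (intro cos_gt_zero_pi) auto
  moreover have "cos t = 1 - 2 * (sin (t / 2))\<^sup>2"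
    using cos_double_sin[of "t / 2"] by simp
  ultimately show ?thesis by simp
qed

lemma DERIV_sigma_fun:
  assumes "\<forall>a\<in>set as. a \<ge> 1" "\<bar>t\<bar> < pi / 2"
  shows "(sigma_fun as has_field_derivative sigma_fun_deriv as t) (at t)"
proof -
  have "((\<lambda>t. (sin (t / 2))\<^sup>2) has_field_derivative sin t / 2) (at t)"
    using sin_double[of "t / 2"] by (auto intro!: derivative_eq_intros)
  from DERIV_chain2[OF DERIV_sigma_series[OF assms(1) sin_half_squared_less[OF assms(2)]] this]
  show ?thesis by (simp add: sigma_fun_def[abs_def] sigma_fun_deriv_def)
qed

text \<open>With \<open>y' = sin t / 2\<close>, one has \<open>y'\<^sup>2 = y (1 - y)\<close> and
  \<open>y'' = 1 / 2 - y\<close>, so the chain rule produces exactly the left side of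
  \<open>sigma_series_ode\<close>.\<close>

lemma DERIV_sigma_fun_deriv:
  assumes "\<forall>a\<in>set as. a \<ge> 1" "\<bar>t\<bar> < pi / 2"
  shows "(sigma_fun_deriv (2 # as) has_field_derivative sigma_fun as t) (at t)"
proof -
  let ?y = "(sin (t / 2))\<^sup>2"
  let ?d1 = "sigma_series_deriv (2 # as) ?y" and ?d2 = "sigma_series_deriv2 (2 # as) ?y"
  have pos: "\<forall>a\<in>set (2 # as). a \<ge> 1" using assms by auto
  have y: "norm ?y < 1 / 2" by (rule sin_half_squared_less[OF assms(2)])
  have "((\<lambda>t. (sin (t / 2))\<^sup>2) has_field_derivative sin t / 2) (at t)"
    using sin_double[of "t / 2"] by (auto intro!: derivative_eq_intros)
  from DERIV_chain2[OF DERIV_sigma_series_deriv[OF pos y] this]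
  have 1: "((\<lambda>t. sigma_series_deriv (2 # as) ((sin (t / 2))\<^sup>2)) has_field_derivative ?d2 * (sin t / 2)) (at t)" .
  have 2: "((\<lambda>t. sin t / 2) has_field_derivative cos t / 2) (at t)"
    by (auto intro!: derivative_eq_intros)
  have "sin t = 2 * sin (t / 2) * cos (t / 2)" "cos t = 1 - 2 * ?y"
    using sin_double[of "t / 2"] cos_double_sin[of "t / 2"] by simp_all
  moreover have "(cos (t / 2))\<^sup>2 = 1 - ?y" by (simp add: cos_squared_eq)
  ultimately have eqs: "(sin t / 2) * (sin t / 2) = ?y * (1 - ?y)" "cos t / 2 = 1 / 2 - ?y"
    by (simp_all add: power2_eq_square)
  have "?d2 * (sin t / 2) * (sin t / 2) + cos t / 2 * ?d1 = sigma_fun as t"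
    unfolding sigma_fun_def sigma_series_ode[OF assms(1) y, symmetric] mult.assoc eqs
    by (simp only: ac_simps)
  with DERIV_mult[OF 1 2] show ?thesis
    by (simp add: sigma_fun_deriv_def[abs_def])
qed

text \<open>Because \<open>y = tan (t / 2) * (sin t / 2)\<close>, the operator \<open>y d/dy\<close>
  becomes \<open>tan (t / 2) d/dt\<close>.\<close>

lemma sigma_fun_1_Cons:
  assumes "\<forall>a\<in>set as. a \<ge> 1" "\<bar>t\<bar> < pi / 2"
  shows "sigma_fun (1 # as) t = tan (t / 2) * sigma_fun_deriv (2 # as) t"
proof -
  have "cos (t / 2) > 0" using assms(2) by (intro cos_gt_zero_pi) auto
  hence "tan (t / 2) * (sin t / 2) = (sin (t / 2))\<^sup>2"
    using sin_double[of "t / 2"] by (simp add: tan_def power2_eq_square)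
  thus ?thesis
    unfolding sigma_fun_def sigma_fun_deriv_def
      sigma_series_1_Cons[OF assms(1) sin_half_squared_less[OF assms(2)]]
    by (metis mult.left_commute mult.commute)
qed

lemma sigma_fun_0 [simp]: "sigma_fun (a # as) 0 = 0"
proof -
  have "sigma_coeff (a # as) 0 = 0" by (simp add: sigma_coeff_def)
  thus ?thesis by (simp add: sigma_fun_def sigma_series_def)
qed

lemma sigma_fun_deriv_0 [simp]: "sigma_fun_deriv as 0 = 0"
  by (simp add: sigma_fun_deriv_def)

lemma sigma_fun_Nil [simp]: "sigma_fun [] t = 1"
proof -
  have "(\<lambda>n. sigma_coeff [] n * y ^ n) sums (\<Sum>n\<in>{0}. sigma_coeff [] n * y ^ n)" for y
    by (rule sums_finite) (auto simp: sigma_coeff_def)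
  thus ?thesis by (simp add: sigma_fun_def sigma_series_def sums_iff sigma_coeff_def)
qed

text \<open>Taylor's formula with integral remainder: each leading 2 is the inverse of a second derivative.\<close>

lemma has_integral_sigma_fun_replicate:
  assumes "\<forall>a\<in>set as. a \<ge> 1" "0 \<le> t" "t < pi / 2"
  shows "((\<lambda>u. (t - u) ^ (2 * m + 1) / fact (2 * m + 1) * sigma_fun as u)
            has_integral sigma_fun (replicate (Suc m) 2 @ as) t) {0..t}"
  using assms(1)
proof (induction m arbitrary: as)
  case 0
  \<comment> \<open>One integration by parts. At \<open>u = t\<close> only the second summand
    survives, and at \<open>u = 0\<close> both vanish.\<close>
  let ?G = "\<lambda>u. (t - u) * sigma_fun_deriv (2 # as) u + sigma_fun (2 # as) u"
  have "((\<lambda>u. (t - u) * sigma_fun as u) has_integral (?G t - ?G 0)) {0..t}"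
  proof (rule has_integral_real_derivative[OF assms(2)])
    fix u assume u: "u \<in> {0..t}"
    show "(?G has_field_derivative (t - u) * sigma_fun as u) (at u)"
      by (rule DERIV_cong[OF DERIV_add[OF DERIV_mult[OF DERIV_diff[OF DERIV_const DERIV_ident]
            DERIV_sigma_fun_deriv[OF 0]] DERIV_sigma_fun]]) (use u assms 0 in auto)
  qed
  thus ?case by simp
next
  case (Suc m)
  let ?K = "\<lambda>n u. (t - u) ^ n / fact n"
  \<comment> \<open>Two integrations by parts: the mixed terms cancel in the derivative of
    \<open>?G\<close>. The kernels vanish at \<open>t\<close> and the functions at 0, so no boundary
    term remains.\<close>
  let ?G = "\<lambda>u. ?K (Suc (Suc (Suc (2 * m)))) u * sigma_fun_deriv (2 # as) u + ?K (Suc (Suc (2 * m))) u * sigma_fun (2 # as) u"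
  let ?g = "\<lambda>u. ?K (Suc (Suc (Suc (2 * m)))) u * sigma_fun as u - ?K (Suc (2 * m)) u * sigma_fun (2 # as) u"
  have pos: "\<forall>a\<in>set (2 # as). a \<ge> 1" using Suc.prems by auto
  have K: "(?K (Suc n) has_field_derivative - ?K n u) (at u)" for n u
  proof -
    have "(?K (Suc n) has_field_derivative (real (Suc n) * (t - u) ^ n * (- 1)) / fact (Suc n)) (at u)"
      by (auto intro!: derivative_eq_intros simp del: fact_Suc power_Suc)
    thus ?thesis by (simp add: fact_Suc del: of_nat_Suc power_Suc)
  qed
  have "(?g has_integral (?G t - ?G 0)) {0..t}"
  proof (rule has_integral_real_derivative[OF assms(2)])
    fix u assume u: "u \<in> {0..t}"
    have "\<bar>u\<bar> < pi / 2" using u assms by auto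
    note d = DERIV_mult[OF K DERIV_sigma_fun_deriv[OF Suc.prems this], of "Suc (Suc (2 * m))"]
             DERIV_mult[OF K DERIV_sigma_fun[OF pos this], of "Suc (2 * m)"]
    show "(?G has_field_derivative ?g u) (at u)"
      by (rule DERIV_cong[OF DERIV_add[OF d]]) (simp add: algebra_simps del: fact_Suc power_Suc)
  qed
  hence "(?g has_integral 0) {0..t}" by simp
  \<comment> \<open>The induction hypothesis is used for \<open>2 # as\<close>: the additional 2
    enters at the inner end of the block.\<close>
  from has_integral_add[OF this Suc.IH[OF pos, unfolded Suc_eq_plus1[symmetric]]]
  have "((\<lambda>u. ?K (Suc (Suc (Suc (2 * m)))) u * sigma_fun as u)
          has_integral sigma_fun (replicate (Suc m) 2 @ 2 # as) t) {0..t}"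
    by (simp only: diff_add_cancel add_0_left)
  moreover have "2 * Suc m + 1 = Suc (Suc (Suc (2 * m)))"
    "replicate (Suc (Suc m)) 2 @ as = replicate (Suc m) 2 @ 2 # as"
    by (simp_all add: replicate_app_Cons_same)
  ultimately show ?case by (simp only:)
qed

lemma sigma_fun_replicate_2:
  assumes "0 \<le> t" "t < pi / 2"
  shows "sigma_fun (replicate (Suc m) 2) t = t ^ (2 * m + 2) / fact (2 * m + 2)"
proof -
  let ?F = "\<lambda>u. - ((t - u) ^ (2 * m + 2) / fact (2 * m + 2))"
  have "((\<lambda>u. (t - u) ^ (2 * m + 1) / fact (2 * m + 1)) has_integral (?F t - ?F 0)) {0..t}"
  proof (rule has_integral_real_derivative[OF assms(1)])
    fix u assume "u \<in> {0..t}"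
    have "(?F has_field_derivative - ((real (2 * m + 2) * (t - u) ^ (2 * m + 1) * (- 1)) / fact (2 * m + 2))) (at u)"
      by (auto intro!: derivative_eq_intros simp del: fact_Suc power_Suc)
    thus "(?F has_field_derivative (t - u) ^ (2 * m + 1) / fact (2 * m + 1)) (at u)"
      by (simp add: fact_Suc[of "Suc (2 * m)"] del: fact_Suc of_nat_Suc power_Suc)
  qed
  moreover have "((\<lambda>u. (t - u) ^ (2 * m + 1) / fact (2 * m + 1))
      has_integral sigma_fun (replicate (Suc m) 2) t) {0..t}"
  proof -
    have "\<forall>a\<in>set []. a \<ge> (1 :: nat)" by simp
    from has_integral_sigma_fun_replicate[OF this assms, of m]
    show ?thesis by (simp only: sigma_fun_Nil append_Nil2 mult_1_right)
  qed
  ultimately have "sigma_fun (replicate (Suc m) 2) t = ?F t - ?F 0"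
    by (rule has_integral_unique[rotated])
  thus ?thesis by (simp del: fact_Suc power_Suc)
qed

text \<open>The preceding closed form is differentiated. It is available only for nonnegative
  \<open>t\<close>, so uniqueness of derivatives is applied at interior points and
  \<open>t = 0\<close> is handled directly.\<close>

lemma sigma_fun_deriv_replicate_2:
  assumes "0 \<le> t" "t < pi / 2"
  shows "sigma_fun_deriv (replicate (Suc m) 2) t = t ^ (2 * m + 1) / fact (2 * m + 1)"
proof (cases "t = 0")
  case False
  have 1: "(sigma_fun (replicate (Suc m) 2) has_field_derivative sigma_fun_deriv (replicate (Suc m) 2) t) (at t)"
    using assms by (intro DERIV_sigma_fun) auto
  have "((\<lambda>t. t ^ (2 * m + 2) / fact (2 * m + 2)) has_field_derivative
          (real (2 * m + 2) * t ^ (2 * m + 1)) / fact (2 * m + 2)) (at t)"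
    by (auto intro!: derivative_eq_intros simp del: fact_Suc power_Suc)
  hence "((\<lambda>t. t ^ (2 * m + 2) / fact (2 * m + 2)) has_field_derivative
          t ^ (2 * m + 1) / fact (2 * m + 1)) (at t)"
    by (simp add: fact_Suc[of "Suc (2 * m)"] del: fact_Suc of_nat_Suc power_Suc)
  hence "(sigma_fun (replicate (Suc m) 2) has_field_derivative t ^ (2 * m + 1) / fact (2 * m + 1)) (at t)"
    by (rule DERIV_cong_ev[OF refl _ refl, THEN iffD1, rotated])
       (use sigma_fun_replicate_2[of _ m] assms False
         eventually_at_in_open[of "{0<..<pi / 2}" t] eventually_nhds_in_open[of "{0<..<pi / 2}" t]
         in \<open>auto elim!: eventually_mono\<close>)
  with 1 show ?thesis by (rule DERIV_unique)
qed simp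

text \<open>The leading block of 2s gives the kernel in \<open>pi / 3 - v\<close>, the entry 1 gives
  the tangent, and that entry with the trailing block gives the derivative of the function for
  \<open>b + 1\<close> 2s.\<close>

lemma has_integral_binomial_sigma:
  "((\<lambda>v. (pi / 3 - v) ^ (2 * m + 1) / fact (2 * m + 1) * (tan (v / 2) * (v ^ (2 * b + 1) / fact (2 * b + 1))))
     has_integral binomial_sigma (replicate (Suc m) 2 @ [1] @ replicate b 2)) {0..pi / 3}"
proof -
  have "((\<lambda>v. (pi / 3 - v) ^ (2 * m + 1) / fact (2 * m + 1) * sigma_fun (1 # replicate b 2) v)
     has_integral sigma_fun (replicate (Suc m) 2 @ 1 # replicate b 2) (pi / 3)) {0..pi / 3}"
    by (rule has_integral_sigma_fun_replicate) auto
  moreover have "sigma_fun (1 # replicate b 2) v = tan (v / 2) * (v ^ (2 * b + 1) / fact (2 * b + 1))"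
    if "v \<in> {0..pi / 3}" for v
  proof -
    have v: "0 \<le> v" "v < pi / 2" using that pi_gt_zero unfolding atLeastAtMost_iff by linarith+
    have "sigma_fun (1 # replicate b 2) v = tan (v / 2) * sigma_fun_deriv (replicate (Suc b) 2) v"
      using sigma_fun_1_Cons[of "replicate b 2" v] v by simp
    thus ?thesis by (simp only: sigma_fun_deriv_replicate_2[OF v])
  qed
  \<comment> \<open>The angle \<open>pi / 3\<close> is the one with
    \<open>(sin (t / 2))\<^sup>2 = 1 / 4\<close>.\<close>
  moreover have "sigma_fun (replicate (Suc m) 2 @ 1 # replicate b 2) (pi / 3) =
      binomial_sigma (replicate (Suc m) 2 @ [1] @ replicate b 2)"
    by (subst binomial_sigma_eq_series) (auto simp: sigma_fun_def sin_30 power_divide)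
  ultimately show ?thesis
    by (subst has_integral_cong[where g = "\<lambda>v. (pi / 3 - v) ^ (2 * m + 1) / fact (2 * m + 1) * sigma_fun (1 # replicate b 2) v"])
       (auto simp del: fact_Suc power_Suc)
qed

section \<open>The tangent integral\<close>

text \<open>Multiplying by \<open>cos (v / 2)\<close> turns each term into a sum of sines at
  neighbouring half-integer frequencies; the alternating signs make it telescope.\<close>

lemma alternating_sine_sum:
  fixes v :: real
  assumes "cos (v / 2) \<noteq> 0"
  shows "(\<Sum>n<N. 2 * (-1) ^ n * sin (real (Suc n) * v))
       = tan (v / 2) - (-1) ^ N * (sin ((real N + 1 / 2) * v) / cos (v / 2))"
proof (induction N)
  case 0
  show ?case by (simp add: tan_def)
next
  case (Suc N)
  have "2 * sin (real (Suc N) * v) * cos (v / 2)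
      = sin ((real (Suc N) + 1 / 2) * v) + sin ((real N + 1 / 2) * v)"
  proof -
    have "(real (Suc N) + 1 / 2) * v = real (Suc N) * v + v / 2"
         "(real N + 1 / 2) * v = real (Suc N) * v - v / 2" by (simp_all add: algebra_simps)
    thus ?thesis by (simp only: sin_add sin_diff)
  qed
  hence "2 * sin (real (Suc N) * v)
      = (sin ((real (Suc N) + 1 / 2) * v) + sin ((real N + 1 / 2) * v)) / cos (v / 2)"
    using assms by (simp add: field_simps)
  hence "2 * (-1) ^ N * sin (real (Suc N) * v)
      = (-1) ^ N * ((sin ((real (Suc N) + 1 / 2) * v) + sin ((real N + 1 / 2) * v)) / cos (v / 2))"
    by (metis mult.assoc mult.commute)
  with Suc show ?case by (simp only: sum.lessThan_Suc) (simp add: add_divide_distrib algebra_simps)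
qed

text \<open>Riemann-Lebesgue for continuously differentiable \<open>g\<close>: one integration by
  parts bounds the integral by a constant over the frequency.\<close>

lemma integral_times_sin_tendsto_0:
  fixes g g' :: "real \<Rightarrow> real"
  assumes "0 \<le> c" and g: "\<And>v. v \<in> {0..c} \<Longrightarrow> (g has_field_derivative g' v) (at v)"
    and g': "continuous_on {0..c} g'"
  shows "(\<lambda>N. integral {0..c} (\<lambda>v. g v * sin ((real N + 1 / 2) * v))) \<longlonglongrightarrow> 0"
proof -
  obtain C where C: "\<And>v. v \<in> {0..c} \<Longrightarrow> \<bar>g' v\<bar> \<le> C"
    using compact_imp_bounded[OF compact_continuous_image[OF g' compact_Icc]]
    unfolding bounded_iff real_norm_def by blast
  have C0: "C \<ge> 0" using C[of 0] assms(1) by auto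
  have cg: "continuous_on {0..c} g"
    by (intro continuous_at_imp_continuous_on ballI DERIV_isCont[OF g])
  have bound: "\<bar>integral {0..c} (\<lambda>v. g v * sin ((real N + 1 / 2) * v))\<bar>
      \<le> (\<bar>g 0\<bar> + \<bar>g c\<bar> + C * c) / (real N + 1 / 2)" for N
  proof -
    define w where "w = real N + 1 / 2"
    have w: "w > 0" by (simp add: w_def)
    let ?G = "\<lambda>v. - (g v * cos (w * v) / w)"
    have "((\<lambda>v. g v * sin (w * v) - g' v * cos (w * v) / w) has_integral (?G c - ?G 0)) {0..c}"
    proof (rule has_integral_real_derivative[OF assms(1)])
      fix v assume v: "v \<in> {0..c}"
      show "(?G has_field_derivative (g v * sin (w * v) - g' v * cos (w * v) / w)) (at v)"
        using w by (auto intro!: derivative_eq_intros g[OF v] simp: field_simps)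
    qed
    moreover have "(\<lambda>v. g' v * cos (w * v) / w) integrable_on {0..c}"
      by (intro integrable_continuous_real continuous_intros g') (use w in auto)
    ultimately have "((\<lambda>v. (g v * sin (w * v) - g' v * cos (w * v) / w) + g' v * cos (w * v) / w)
        has_integral (?G c - ?G 0 + integral {0..c} (\<lambda>v. g' v * cos (w * v) / w))) {0..c}"
      by (intro has_integral_add integrable_integral)
    hence eq: "integral {0..c} (\<lambda>v. g v * sin (w * v))
        = ?G c - ?G 0 + integral {0..c} (\<lambda>v. g' v * cos (w * v) / w)"
      by (simp add: integral_unique)
    have "norm (integral {0..c} (\<lambda>v. g' v * cos (w * v) / w)) \<le> C / w * (c - 0)"
    proof (rule integral_bound[OF assms(1)])
      show "continuous_on {0..c} (\<lambda>v. g' v * cos (w * v) / w)"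
        by (intro continuous_intros g') (use w in auto)
      fix v assume "v \<in> {0..c}"
      hence "\<bar>g' v\<bar> * \<bar>cos (w * v)\<bar> \<le> C * 1"
        using C C0 by (intro mult_mono) auto
      thus "norm (g' v * cos (w * v) / w) \<le> C / w"
        using w by (simp add: abs_mult divide_right_mono)
    qed
    moreover have "\<bar>?G c\<bar> \<le> \<bar>g c\<bar> / w" "\<bar>?G 0\<bar> \<le> \<bar>g 0\<bar> / w"
      using w mult_left_le[of "\<bar>cos (w * c)\<bar>" "\<bar>g c\<bar>"] by (simp_all add: abs_mult divide_right_mono)
    ultimately have "\<bar>integral {0..c} (\<lambda>v. g v * sin (w * v))\<bar> \<le> \<bar>g c\<bar> / w + \<bar>g 0\<bar> / w + C / w * c"
      unfolding eq real_norm_def diff_0_right by linarith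
    thus ?thesis by (simp add: w_def add_divide_distrib)
  qed
  have "(\<lambda>N. (\<bar>g 0\<bar> + \<bar>g c\<bar> + C * c) / (real N + 1 / 2)) \<longlonglongrightarrow> 0"
    using filterlim_tendsto_add_at_top[OF tendsto_const filterlim_real_sequentially, of "1 / 2"]
    by (intro tendsto_divide_0[OF tendsto_const] filterlim_at_top_imp_at_infinity) (simp add: add.commute)
  thus ?thesis
    by (rule Lim_null_comparison[rotated]) (use bound in auto)
qed

text \<open>Termwise integration is justified through partial sums, whose error is an oscillatory
  integral. The condition \<open>c < pi\<close> keeps \<open>cos (v / 2)\<close> away from
  zero.\<close>

lemma sums_integral_poly_tan:
  fixes p :: "real poly"
  assumes "0 \<le> c" "c < pi"
  shows "(\<lambda>n. 2 * (-1) ^ n * integral {0..c} (\<lambda>v. poly p v * sin (real (Suc n) * v)))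
           sums integral {0..c} (\<lambda>v. poly p v * tan (v / 2))"
proof -
  define g where "g = (\<lambda>v. poly p v / cos (v / 2))"
  have cos: "cos (v / 2) \<noteq> 0" if "v \<in> {0..c}" for v
    using cos_gt_zero_pi[of "v / 2"] that assms by auto
  have lim: "(\<lambda>N. integral {0..c} (\<lambda>v. g v * sin ((real N + 1 / 2) * v))) \<longlonglongrightarrow> 0"
  proof (rule integral_times_sin_tendsto_0[OF assms(1)])
    fix v assume v: "v \<in> {0..c}"
    show "(g has_field_derivative (poly (pderiv p) v * cos (v / 2) + poly p v * sin (v / 2) / 2)
            / (cos (v / 2))\<^sup>2) (at v)"
      unfolding g_def using cos[OF v]
      by (auto intro!: derivative_eq_intros poly_DERIV simp: power2_eq_square)
  qed (use cos in \<open>auto intro!: continuous_intros\<close>)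
  have cont_g: "continuous_on {0..c} g"
    unfolding g_def using cos by (auto intro!: continuous_intros)
  have tan: "continuous_on {0..c} (\<lambda>v. poly p v * tan (v / 2))"
    using cos by (auto intro!: continuous_intros)
  have part: "(\<Sum>n<N. 2 * (-1) ^ n * integral {0..c} (\<lambda>v. poly p v * sin (real (Suc n) * v)))
      = integral {0..c} (\<lambda>v. poly p v * tan (v / 2))
        - (-1) ^ N * integral {0..c} (\<lambda>v. g v * sin ((real N + 1 / 2) * v))" for N
  proof -
    have "(\<Sum>n<N. 2 * (-1) ^ n * integral {0..c} (\<lambda>v. poly p v * sin (real (Suc n) * v)))
        = (\<Sum>n<N. integral {0..c} (\<lambda>v. 2 * (-1) ^ n * (poly p v * sin (real (Suc n) * v))))"
      by (simp only: integral_mult_right)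
    also have "\<dots> = integral {0..c} (\<lambda>v. \<Sum>n<N. 2 * (-1) ^ n * (poly p v * sin (real (Suc n) * v)))"
      by (rule integral_sum[symmetric])
         (auto intro!: integrable_continuous_real continuous_intros)
    also have "\<dots> = integral {0..c} (\<lambda>v. poly p v * tan (v / 2)
        - (-1) ^ N * (g v * sin ((real N + 1 / 2) * v)))"
    proof (rule integral_cong)
      fix v assume v: "v \<in> {0..c}"
      have "(\<Sum>n<N. 2 * (-1) ^ n * (poly p v * sin (real (Suc n) * v)))
          = poly p v * (\<Sum>n<N. 2 * (-1) ^ n * sin (real (Suc n) * v))"
        unfolding sum_distrib_left by (intro sum.cong refl) (simp only: mult_ac)
      also have "\<dots> = poly p v * tan (v / 2) - (-1) ^ N * (g v * sin ((real N + 1 / 2) * v))"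
        unfolding alternating_sine_sum[OF cos[OF v]] g_def by (simp add: algebra_simps)
      finally show "(\<Sum>n<N. 2 * (-1) ^ n * (poly p v * sin (real (Suc n) * v)))
          = poly p v * tan (v / 2) - (-1) ^ N * (g v * sin ((real N + 1 / 2) * v))" .
    qed
    also have "\<dots> = integral {0..c} (\<lambda>v. poly p v * tan (v / 2))
        - integral {0..c} (\<lambda>v. (-1) ^ N * (g v * sin ((real N + 1 / 2) * v)))"
      by (intro integral_diff integrable_continuous_real tan continuous_intros cont_g)
    finally show ?thesis by (simp only: integral_mult_right)
  qed
  have "(\<lambda>N. (-1) ^ N * integral {0..c} (\<lambda>v. g v * sin ((real N + 1 / 2) * v))) \<longlonglongrightarrow> 0"
    using lim by (rule Lim_null_comparison[rotated, OF tendsto_norm_zero]) (simp add: abs_mult)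
  from tendsto_diff[OF tendsto_const this] show ?thesis
    unfolding sums_def part by simp
qed

text \<open>Repeated integration by parts. Phase shifts by \<open>pi / 2\<close> write all iterated
  antiderivatives of the sine uniformly.\<close>

lemma integral_poly_sin:
  fixes p :: "real poly"
  assumes "0 \<le> c" "w > 0" "degree p \<le> d"
  shows "integral {0..c} (\<lambda>v. poly p v * sin (w * v)) =
    (\<Sum>j\<le>d. (-1) ^ j * (poly ((pderiv ^^ j) p) c * sin (w * c - real (Suc j) * (pi / 2))
        + poly ((pderiv ^^ j) p) 0 * sin (real (Suc j) * (pi / 2))) / w ^ Suc j)"
proof -
  \<comment> \<open>\<open>X j\<close> is, up to sign, the integrand left after \<open>j\<close>
    integrations by parts and \<open>E j\<close> the next boundary term. Since \<open>E j\<close>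
    has derivative \<open>X j - X (Suc j)\<close>, the sum telescopes.\<close>
  define X where "X = (\<lambda>j v. (-1) ^ j * poly ((pderiv ^^ j) p) v * sin (w * v - real j * (pi / 2)) / w ^ j)"
  define E where "E = (\<lambda>j v. (-1) ^ j / w ^ Suc j * (poly ((pderiv ^^ j) p) v * sin (w * v - real (Suc j) * (pi / 2))))"
  have dE: "(E j has_field_derivative X j v - X (Suc j) v) (at v)" for j v
  proof -
    have "cos (w * v - real (Suc j) * (pi / 2)) = sin (w * v - real j * (pi / 2))"
    proof -
      have "w * v - real (Suc j) * (pi / 2) = (w * v - real j * (pi / 2)) - pi / 2"
        by (simp add: algebra_simps)
      thus ?thesis by (simp only: cos_diff) simp
    qed
    moreover have "((\<lambda>v. sin (w * v - real (Suc j) * (pi / 2))) has_field_derivative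
        cos (w * v - real (Suc j) * (pi / 2)) * w) (at v)"
      by (auto intro!: derivative_eq_intros simp del: of_nat_Suc)
    note DERIV_cmult[OF DERIV_mult[OF poly_DERIV this], of "(-1) ^ j / w ^ Suc j" "(pderiv ^^ j) p"]
    ultimately show ?thesis
      unfolding E_def X_def using assms(2)
      by (elim DERIV_cong) (simp add: add_divide_distrib algebra_simps del: of_nat_Suc)
  qed
  have "((\<lambda>v. poly p v * sin (w * v)) has_integral ((\<Sum>j\<le>d. E j c) - (\<Sum>j\<le>d. E j 0))) {0..c}"
  proof (rule has_integral_real_derivative[OF assms(1)])
    fix v
    have "(pderiv ^^ Suc d) p = 0"
    proof -
      have "degree ((pderiv ^^ j) p) \<le> degree p - j" for j
        by (induction j) (auto simp: degree_pderiv)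
      hence "degree ((pderiv ^^ d) p) = 0" using assms(3) by (metis diff_is_0_eq le_zero_eq)
      thus ?thesis by (simp add: pderiv_eq_0_iff)
    qed
    hence "X 0 v - X (Suc d) v = poly p v * sin (w * v)" by (simp add: X_def del: funpow.simps)
    moreover have "(\<Sum>j\<le>d. X j v - X (Suc j) v) = X 0 v - X (Suc d) v"
      by (rule sum_telescope)
    moreover have "((\<lambda>v. \<Sum>j\<le>d. E j v) has_field_derivative (\<Sum>j\<le>d. X j v - X (Suc j) v)) (at v)"
      by (intro DERIV_sum dE)
    ultimately show "((\<lambda>v. \<Sum>j\<le>d. E j v) has_field_derivative poly p v * sin (w * v)) (at v)"
      by (simp only:)
  qed
  hence "integral {0..c} (\<lambda>v. poly p v * sin (w * v)) = (\<Sum>j\<le>d. E j c - E j 0)"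
    by (simp add: integral_unique sum_subtractf)
  \<comment> \<open>The contribution at 0 acquires a plus sign because the sine is odd.\<close>
  also have "\<dots> = (\<Sum>j\<le>d. (-1) ^ j * (poly ((pderiv ^^ j) p) c * sin (w * c - real (Suc j) * (pi / 2))
        + poly ((pderiv ^^ j) p) 0 * sin (real (Suc j) * (pi / 2))) / w ^ Suc j)"
    by (intro sum.cong refl)
       (simp add: E_def diff_divide_distrib add_divide_distrib algebra_simps del: power_Suc of_nat_Suc)
  finally show ?thesis .
qed

section \<open>Boundary terms and the values of the series\<close>

lemma pcompose_power: "pcompose (p ^ n) q = pcompose p q ^ n" for p q :: "'a :: comm_semiring_1 poly"
  by (induction n) (simp_all add: pcompose_mult pcompose_1)

text \<open>Taylor coefficients at \<open>c\<close> are the coefficients after the shift by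
  \<open>c\<close>, which commutes with differentiation.\<close>

lemma poly_higher_pderiv_eq_coeff:
  fixes p :: "real poly"
  shows "poly ((pderiv ^^ j) p) c = fact j * coeff (pcompose p [:c, 1:]) j"
proof -
  have "pcompose ((pderiv ^^ j) p) [:c, 1:] = (pderiv ^^ j) (pcompose p [:c, 1:])"
  proof (induction j)
    case (Suc j)
    have "pcompose (pderiv q) [:c, 1:] = pderiv (pcompose q [:c, 1:])" for q :: "real poly"
      by (simp add: pderiv_pcompose pderiv_pCons)
    with Suc show ?case by simp
  qed simp
  moreover have "poly ((pderiv ^^ j) p) c = coeff (pcompose ((pderiv ^^ j) p) [:c, 1:]) 0"
    by (simp add: poly_pcompose flip: poly_0_coeff_0)
  ultimately show ?thesis
    by (simp add: coeff_higher_pderiv pochhammer_fact)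
qed

text \<open>The factorials regroup into \<open>j choose m\<close>; for \<open>j < m\<close> both
  sides vanish. The two endpoints use \<open>e = -1\<close> and \<open>e = 1\<close>.\<close>

lemma fact_coeff_monom_mult_linear_power:
  fixes c e :: real
  assumes "j \<le> m + l"
  shows "fact j * coeff (monom 1 m * [:c, e:] ^ l) j / (fact m * fact l)
       = real (j choose m) * e ^ (j - m) * (c ^ (m + l - j) / fact (m + l - j))"
proof (cases "j < m")
  case False
  then obtain i where j: "j = m + i" and i: "i \<le> l"
    using assms by (metis add_le_cancel_left le_Suc_ex linorder_not_less)
  have "real ((m + i) choose m) = fact (m + i) / (fact m * fact i)"
    using binomial_fact[of m "m + i", where 'a = real] by simp
  moreover have "real (l choose i) = fact l / (fact i * fact (l - i))"
    using binomial_fact[OF i, where 'a = real] by simp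
  ultimately show ?thesis
    using i by (simp add: j coeff_monom_mult coeff_linear_poly_power ac_simps)
qed (simp add: coeff_monom_mult)

section \<open>Evaluation of the resulting Dirichlet series\<close>

lemma zeta_sums:
  assumes "s \<ge> 2"
  shows "(\<lambda>n. 1 / real (Suc n) ^ s) sums zeta (real s)"
proof -
  have "summable (\<lambda>n. 1 / real (Suc n) ^ s)"
    using inverse_power_summable[OF assms, where 'a = real]
    by (subst summable_Suc_iff) (simp add: inverse_eq_divide)
  thus ?thesis
    by (simp add: zeta_def powr_realpow sums_iff)
qed

text \<open>Index \<open>n\<close> stands for the integer \<open>n + 1\<close>, so the multiples of
  \<open>q\<close> sit at the indices \<open>q * Suc n - 1\<close>; elsewhere the terms
  vanish.\<close>

lemma zeta_multiples_sums:
  assumes "s \<ge> 2" "q \<ge> 1"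
  shows "(\<lambda>n. if q dvd Suc n then 1 / real (Suc n) ^ s else 0) sums (zeta (real s) / real q ^ s)"
proof -
  let ?f = "\<lambda>n. if q dvd Suc n then 1 / real (Suc n) ^ s else 0"
  have sums: "(\<lambda>n. ?f (q * Suc n - 1)) sums (zeta (real s) / real q ^ s)"
  proof -
    have "?f (q * Suc n - 1) = 1 / real (Suc n) ^ s / real q ^ s" for n
    proof -
      have "Suc (q * Suc n - 1) = q * Suc n" using assms(2) by simp
      thus ?thesis by (simp only: dvd_triv_left if_True of_nat_mult power_mult_distrib) simp
    qed
    thus ?thesis using sums_divide[OF zeta_sums[OF assms(1)]] by presburger
  qed
  have mono: "strict_mono (\<lambda>n. q * Suc n - 1)"
    using assms(2) by (intro strict_monoI_Suc) auto
  have zero: "?f n = 0" if "n \<notin> range (\<lambda>n. q * Suc n - 1)" for n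
  proof -
    have "\<not> q dvd Suc n"
    proof
      assume "q dvd Suc n"
      then obtain i where i: "Suc n = q * i" by (rule dvdE)
      then obtain i' where "i = Suc i'" by (cases i) auto
      with i have "n = q * Suc i' - 1" by simp
      with that show False by blast
    qed
    thus ?thesis by simp
  qed
  show ?thesis by (rule sums_mono_reindex[THEN iffD1, OF mono zero sums])
qed

text \<open>The sign \<open>(-1) ^ n\<close> is 1 minus twice the indicator of even
  \<open>n + 1\<close>.\<close>

lemma alternating_zeta_sums:
  assumes "s \<ge> 2"
  shows "(\<lambda>n. (-1) ^ n / real (Suc n) ^ s) sums ((1 - 2 / 2 ^ s) * zeta (real s))"
proof -
  have "(\<lambda>n. 1 / real (Suc n) ^ s - 2 * (if 2 dvd Suc n then 1 / real (Suc n) ^ s else 0))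
          sums (zeta (real s) - 2 * (zeta (real s) / real 2 ^ s))"
    using assms by (intro sums_diff sums_mult zeta_sums zeta_multiples_sums) auto
  also have "(\<lambda>n. 1 / real (Suc n) ^ s - 2 * (if 2 dvd Suc n then 1 / real (Suc n) ^ s else 0))
      = (\<lambda>n. (-1) ^ n / real (Suc n) ^ s)"
    by (auto simp: fun_eq_iff)
  finally show ?thesis by (simp add: algebra_simps)
qed

lemma induct_mod_3 [case_names 0 1 2 add3]:
  fixes n :: nat
  assumes "P 0" "P 1" "P 2" "\<And>n. P n \<Longrightarrow> P (n + 3)"
  shows "P n"
proof (induction n rule: less_induct)
  case (less n)
  show ?case
  proof (cases "n < 3")
    case True
    hence "n = 0 \<or> n = 1 \<or> n = 2" by auto
    with assms show ?thesis by auto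
  next
    case False
    with less[of "n - 3"] assms(4)[of "n - 3"] show ?thesis by auto
  qed
qed

text \<open>Adding 3 to \<open>n\<close> shifts the angle by \<open>pi\<close> and flips both
  factors, so the product has period 3.\<close>

lemma alternating_cos_third_pi:
  "2 * (-1) ^ n * cos (real (Suc n) * (pi / 3)) = (if 3 dvd Suc n then -2 else 1)"
proof (induction n rule: induct_mod_3)
  case 0
  show ?case by (simp add: cos_60)
next
  case 1
  have "\<not> 3 dvd Suc 1" by presburger
  thus ?case using cos_120 by simp
next
  case 2
  show ?case by simp
next
  case (add3 n)
  have "real (Suc (n + 3)) * (pi / 3) = real (Suc n) * (pi / 3) + pi" by (simp add: field_simps)
  moreover have "3 dvd Suc (n + 3) \<longleftrightarrow> 3 dvd Suc n" by presburger
  ultimately show ?case using add3 by (simp only: cos_add power_add) simp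
qed

text \<open>The same periodicity, now with an odd pattern of values: this is where the character
  modulo 3 appears.\<close>

lemma alternating_sin_third_pi:
  "2 * (-1) ^ n * sin (real (Suc n) * (pi / 3)) = sqrt 3 * chi3 (Suc n)"
proof (induction n rule: induct_mod_3)
  case 0
  show ?case by (simp add: sin_60 chi3_def)
next
  case 1
  show ?case using sin_120 by (simp add: chi3_def)
next
  case 2
  show ?case by (simp add: chi3_def)
next
  case (add3 n)
  have "real (Suc (n + 3)) * (pi / 3) = real (Suc n) * (pi / 3) + pi" by (simp add: field_simps)
  moreover have "chi3 (Suc (n + 3)) = chi3 (Suc n)"
  proof -
    have "Suc (n + 3) mod 3 = Suc n mod 3" by presburger
    thus ?thesis by (simp only: chi3_def)
  qed
  ultimately show ?case using add3 by (simp only: sin_add power_add) simp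
qed

text \<open>The coefficient is 1 minus three times the indicator of multiples of 3.\<close>

lemma alternating_cos_third_pi_sums:
  assumes "s \<ge> 2"
  shows "(\<lambda>n. 2 * (-1) ^ n * cos (real (Suc n) * (pi / 3)) / real (Suc n) ^ s)
           sums ((1 - 3 / 3 ^ s) * zeta (real s))"
proof -
  have "(\<lambda>n. 1 / real (Suc n) ^ s - 3 * (if 3 dvd Suc n then 1 / real (Suc n) ^ s else 0))
          sums (zeta (real s) - 3 * (zeta (real s) / real 3 ^ s))"
    using assms by (intro sums_diff sums_mult zeta_sums zeta_multiples_sums) auto
  also have "(\<lambda>n. 1 / real (Suc n) ^ s - 3 * (if 3 dvd Suc n then 1 / real (Suc n) ^ s else 0))
      = (\<lambda>n. 2 * (-1) ^ n * cos (real (Suc n) * (pi / 3)) / real (Suc n) ^ s)"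
    unfolding alternating_cos_third_pi by (auto simp: fun_eq_iff)
  finally show ?thesis by (simp add: algebra_simps)
qed

lemma alternating_sin_third_pi_sums:
  assumes "s \<ge> 2"
  shows "(\<lambda>n. 2 * (-1) ^ n * sin (real (Suc n) * (pi / 3)) / real (Suc n) ^ s)
           sums (sqrt 3 * L_series (real s) chi3)"
proof -
  have "summable (\<lambda>n. chi3 (Suc n) / real (Suc n) ^ s)"
    by (rule summable_comparison_test'[OF sums_summable[OF zeta_sums[OF assms]], of 0])
       (auto simp: chi3_def)
  hence "(\<lambda>n. chi3 (Suc n) / real (Suc n) ^ s) sums L_series (real s) chi3"
    by (simp add: L_series_def powr_realpow sums_iff)
  from sums_mult[OF this, of "sqrt 3"] show ?thesis
    unfolding alternating_sin_third_pi by simp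
qed

lemma sum_split_parity:
  fixes f :: "nat \<Rightarrow> real"
  shows "(\<Sum>j\<le>2 * M. f j) = (\<Sum>r=0..M. f (2 * r)) + (\<Sum>r=1..M. f (2 * r - 1))"
  by (induction M) (simp_all add: algebra_simps)

section \<open>Assembly of the boundary terms\<close>

theorem theorem5:
  fixes a b k :: nat
  assumes "a \<ge> 1" and "k = 2 * a + 2 * b + 1"
  shows "binomial_sigma (replicate a 2 @ [1] @ replicate b 2) =
      (\<Sum>r=a..a+b. real ((2*r) choose (2*a-1)) * ((pi/3) ^ (k-1-2*r) / fact (k-1-2*r))
          * (-1) ^ r * (1 - 1 / 3 ^ (2*r)) * zeta (real (2*r+1)))
    + (\<Sum>r=a..a+b. real ((2*r-1) choose (2*a-1)) * ((pi/3) ^ (k-2*r) / fact (k-2*r))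
          * (-1) ^ r * sqrt 3 * L_series (real (2*r)) chi3)
    - (\<Sum>r=b+1..a+b. real ((2*r) choose (2*b+1)) * ((pi/3) ^ (k-1-2*r) / fact (k-1-2*r))
          * (-1) ^ r * (2 * (1 - 1 / 2 ^ (2*r))) * zeta (real (2*r+1)))"
proof -
  define c :: real where "c = pi / 3"
  define m l where "m = 2 * a - 1" and "l = 2 * b + 1"
  have ml: "odd m" "odd l" "m + l = 2 * (a + b)"
    using assms(1) by (auto simp: m_def l_def)
  have c: "0 \<le> c" "c < pi" by (simp_all add: c_def)
  define p where "p = smult (1 / (fact m * fact l)) ([:c, -1:] ^ m * monom 1 l)"
  define D where "D = (\<lambda>j x. poly ((pderiv ^^ j) p) x)"
  define K where "K = (\<lambda>j. c ^ (m + l - j) / fact (m + l - j))"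

  have deg: "degree p \<le> 2 * (a + b)"
  proof -
    have "degree p \<le> degree ([:c, -1:] ^ m) + degree (monom (1 :: real) l)"
      unfolding p_def by (rule order.trans[OF degree_smult_le degree_mult_le])
    also have "\<dots> \<le> m + l"
      by (intro add_mono degree_monom_le) (use degree_power_le[of "[:c, -1:]" m] in simp)
    finally show ?thesis by (simp add: ml)
  qed
  \<comment> \<open>Only even \<open>j\<close> matter at 0, since
    \<open>sin (real (Suc j) * (pi / 2))\<close> vanishes for odd \<open>j\<close>. The sign is
    \<open>(-1) ^ (j - l)\<close> with \<open>l\<close> odd; for \<open>j < l\<close> the zero of
    order \<open>l\<close> makes both sides 0.\<close>
  have D0: "D j 0 = - real (j choose l) * K j" if "even j" "j \<le> 2 * (a + b)" for j
  proof (cases "j < l")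
    case False
    hence "odd (j - l)" using that ml by simp
    moreover have "D j 0 = fact j * coeff (monom 1 l * [:c, -1:] ^ m) j / (fact l * fact m)"
      unfolding D_def poly_higher_pderiv_eq_coeff by (simp add: p_def mult.commute pcompose_idR)
    ultimately show ?thesis
      using fact_coeff_monom_mult_linear_power[of j l m c "-1"] that ml
      by (simp add: K_def add.commute)
  next
    case True
    thus ?thesis
      unfolding D_def poly_higher_pderiv_eq_coeff
      by (simp add: p_def coeff_monom_mult mult.commute[of _ "monom _ _"])
  qed
  \<comment> \<open>After the shift by \<open>c\<close> the factor \<open>c - v\<close> becomes
    minus the variable, and \<open>m\<close> is odd.\<close>
  have Dc: "D j c = - real (j choose m) * K j" if "j \<le> 2 * (a + b)" for j
  proof -
    have "[:0, -1:] ^ m = - (monom 1 m :: real poly)"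
    proof -
      have "[:0, -1 :: real:] = monom (-1) 1" by (simp add: monom_Suc monom_0)
      thus ?thesis using ml by (simp add: monom_power minus_monom)
    qed
    moreover have "pcompose (monom 1 l) [:c, 1:] = [:c, 1:] ^ l"
      by (simp add: monom_altdef pcompose_power pcompose_pCons)
    ultimately have "pcompose p [:c, 1:] = - smult (1 / (fact m * fact l)) (monom 1 m * [:c, 1:] ^ l)"
      by (simp add: p_def pcompose_smult pcompose_mult pcompose_power pcompose_pCons)
    hence "D j c = - (fact j * coeff (monom 1 m * [:c, 1:] ^ l) j / (fact m * fact l))"
      unfolding D_def poly_higher_pderiv_eq_coeff by simp
    thus ?thesis
      using fact_coeff_monom_mult_linear_power[of j m l c 1] that ml by (simp add: K_def)
  qed

  \<comment> \<open>\<open>t j n\<close> is the \<open>j\<close>-th boundary term in the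
    \<open>n\<close>-th summand of the tangent expansion; \<open>S j\<close> will be its sum over
    \<open>n\<close>.\<close>
  define t where "t = (\<lambda>j n. 2 * (-1) ^ n * ((-1) ^ j *
      (D j c * sin (real (Suc n) * c - real (Suc j) * (pi / 2)) + D j 0 * sin (real (Suc j) * (pi / 2)))
      / real (Suc n) ^ Suc j))"
  define S where "S = (\<lambda>j. if even j
      then (-1) ^ (j div 2) * real (j choose m) * K j * ((1 - 1 / 3 ^ j) * zeta (real (j + 1)))
         - (-1) ^ (j div 2) * real (j choose l) * K j * (2 * (1 - 1 / 2 ^ j) * zeta (real (j + 1)))
      else (-1) ^ ((j + 1) div 2) * real (j choose m) * K j * (sqrt 3 * L_series (real (j + 1)) chi3))"
  have t_sums: "t j sums S j" if j: "j \<le> 2 * (a + b)" for j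
  proof (cases "even j")
    case True
    then obtain r where r: "j = 2 * r" by blast
    show ?thesis
    \<comment> \<open>Here the exponent \<open>j + 1\<close> is 1, outside the range of the zeta
      series, but \<open>p\<close> vanishes at both endpoints, so the whole term is 0.\<close>
    proof (cases "r = 0")
      case True
      have "l > 0" "m > 0" using ml odd_pos by auto
      hence "D 0 0 = 0" "D 0 c = 0" using D0[of 0] Dc[of 0] by simp_all
      thus ?thesis by (simp add: t_def S_def r True)
    next
      case False
      hence s: "j + 1 \<ge> 2" using r by simp
      have "sin (real (Suc n) * c - real (Suc j) * (pi / 2)) = - ((-1) ^ r * cos (real (Suc n) * c))"
        and "sin (real (Suc j) * (pi / 2)) = (-1) ^ r" for n
      proof -
        have "real (Suc j) * (pi / 2) = real r * pi + pi / 2" by (simp add: r algebra_simps)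
        thus "sin (real (Suc n) * c - real (Suc j) * (pi / 2)) = - ((-1) ^ r * cos (real (Suc n) * c))"
          "sin (real (Suc j) * (pi / 2)) = (-1) ^ r"
          by (simp_all only: sin_diff sin_add cos_add sin_npi cos_npi sin_pi_half cos_pi_half) simp_all
      qed
      hence "t j n = (-1) ^ r * real (j choose m) * K j * (2 * (-1) ^ n * cos (real (Suc n) * (pi / 3)) / real (Suc n) ^ (j + 1))
          - (-1) ^ r * real (j choose l) * K j * (2 * ((-1) ^ n / real (Suc n) ^ (j + 1)))" for n
        unfolding t_def D0[OF \<open>even j\<close> j] Dc[OF j] using \<open>even j\<close>
        by (simp add: c_def add_divide_distrib diff_divide_distrib algebra_simps del: power_Suc of_nat_Suc)
      moreover have "(\<lambda>n. (-1) ^ r * real (j choose m) * K j * (2 * (-1) ^ n * cos (real (Suc n) * (pi / 3)) / real (Suc n) ^ (j + 1))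
          - (-1) ^ r * real (j choose l) * K j * (2 * ((-1) ^ n / real (Suc n) ^ (j + 1))))
        sums ((-1) ^ r * real (j choose m) * K j * ((1 - 3 / 3 ^ (j + 1)) * zeta (real (j + 1)))
          - (-1) ^ r * real (j choose l) * K j * (2 * ((1 - 2 / 2 ^ (j + 1)) * zeta (real (j + 1)))))"
        by (intro sums_diff sums_mult alternating_cos_third_pi_sums alternating_zeta_sums s)
      ultimately have "(\<lambda>n. t j n) sums ((-1) ^ r * real (j choose m) * K j * ((1 - 3 / 3 ^ (j + 1)) * zeta (real (j + 1)))
          - (-1) ^ r * real (j choose l) * K j * (2 * ((1 - 2 / 2 ^ (j + 1)) * zeta (real (j + 1)))))"
        by (simp only:)
      also have "(-1) ^ r * real (j choose m) * K j * ((1 - 3 / 3 ^ (j + 1)) * zeta (real (j + 1)))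
          - (-1) ^ r * real (j choose l) * K j * (2 * ((1 - 2 / 2 ^ (j + 1)) * zeta (real (j + 1)))) = S j"
        by (simp add: S_def r algebra_simps)
      finally show ?thesis .
    qed
  next
    case False
    then obtain r where r: "j + 1 = 2 * r" by (metis evenE odd_even_add odd_one)
    hence s: "j + 1 \<ge> 2" by simp
    have "sin (real (Suc n) * c - real (Suc j) * (pi / 2)) = (-1) ^ r * sin (real (Suc n) * c)"
      and "sin (real (Suc j) * (pi / 2)) = 0" for n
    proof -
      have "real (Suc j) = 2 * real r" using r by linarith
      hence "real (Suc j) * (pi / 2) = real r * pi" by simp
      thus "sin (real (Suc n) * c - real (Suc j) * (pi / 2)) = (-1) ^ r * sin (real (Suc n) * c)"
        "sin (real (Suc j) * (pi / 2)) = 0"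
        by (simp_all only: sin_diff sin_npi cos_npi) simp_all
    qed
    hence "t j n = (-1) ^ r * real (j choose m) * K j * (2 * (-1) ^ n * sin (real (Suc n) * (pi / 3)) / real (Suc n) ^ (j + 1))" for n
      unfolding t_def Dc[OF j] using False
      by (simp add: c_def algebra_simps del: power_Suc of_nat_Suc)
    hence "t j sums ((-1) ^ r * real (j choose m) * K j * (sqrt 3 * L_series (real (j + 1)) chi3))"
      using sums_mult[OF alternating_sin_third_pi_sums[OF s]] by presburger
    moreover have "(j + 1) div 2 = r" using r by simp
    ultimately show ?thesis using False by (simp only: S_def if_False)
  qed

  \<comment> \<open>The sum over \<open>j\<close> is finite, so it may be exchanged with the series;
    uniqueness of sums then identifies the result with the tangent integral.\<close>
  have "(\<lambda>n. \<Sum>j\<le>2 * (a + b). t j n) sums (\<Sum>j\<le>2 * (a + b). S j)"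
    by (rule sums_sum) (use t_sums in auto)
  also have "(\<lambda>n. \<Sum>j\<le>2 * (a + b). t j n) =
      (\<lambda>n. 2 * (-1) ^ n * integral {0..c} (\<lambda>v. poly p v * sin (real (Suc n) * v)))"
    unfolding t_def D_def by (subst integral_poly_sin[OF c(1) _ deg]) (simp_all only: sum_distrib_left of_nat_0_less_iff zero_less_Suc)
  finally have "(\<Sum>j\<le>2 * (a + b). S j) = integral {0..c} (\<lambda>v. poly p v * tan (v / 2))"
    using sums_integral_poly_tan[OF c, of p] by (rule sums_unique2)
  also have "\<dots> = binomial_sigma (replicate a 2 @ [1] @ replicate b 2)"
  proof -
    have "2 * (a - 1) + 1 = m" "Suc (a - 1) = a" using assms(1) by (simp_all add: m_def)
    hence "((\<lambda>v. (c - v) ^ m / fact m * (tan (v / 2) * (v ^ l / fact l)))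
        has_integral binomial_sigma (replicate a 2 @ [1] @ replicate b 2)) {0..c}"
      using has_integral_binomial_sigma[of "a - 1" b] by (simp only: c_def l_def)
    moreover have "(\<lambda>v. (c - v) ^ m / fact m * (tan (v / 2) * (v ^ l / fact l))) = (\<lambda>v. poly p v * tan (v / 2))"
      by (simp add: p_def poly_monom fun_eq_iff)
    ultimately show ?thesis by (simp only: integral_unique)
  qed
  finally have sigma: "binomial_sigma (replicate a 2 @ [1] @ replicate b 2) =
      (\<Sum>r=0..a+b. S (2 * r)) + (\<Sum>r=1..a+b. S (2 * r - 1))"
    unfolding sum_split_parity by simp

  \<comment> \<open>Here \<open>m + l = k - 1\<close>. In the odd case \<open>r \<ge> 1\<close>
    keeps the truncated subtraction \<open>2 * r - 1\<close> exact.\<close>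
  have K: "K (2 * r) = (pi / 3) ^ (k - 1 - 2 * r) / fact (k - 1 - 2 * r)"
    "r \<ge> 1 \<Longrightarrow> K (2 * r - 1) = (pi / 3) ^ (k - 2 * r) / fact (k - 2 * r)" for r
    using assms(2) ml(3) by (simp_all add: K_def c_def)
  define A where "A = (\<lambda>r. real ((2*r) choose (2*a-1)) * ((pi/3) ^ (k-1-2*r) / fact (k-1-2*r))
          * (-1) ^ r * (1 - 1 / 3 ^ (2*r)) * zeta (real (2*r+1)))"
  define B where "B = (\<lambda>r. real ((2*r-1) choose (2*a-1)) * ((pi/3) ^ (k-2*r) / fact (k-2*r))
          * (-1) ^ r * sqrt 3 * L_series (real (2*r)) chi3)"
  define C where "C = (\<lambda>r. real ((2*r) choose (2*b+1)) * ((pi/3) ^ (k-1-2*r) / fact (k-1-2*r))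
          * (-1) ^ r * (2 * (1 - 1 / 2 ^ (2*r))) * zeta (real (2*r+1)))"
  have "(\<Sum>r=0..a+b. S (2 * r)) = (\<Sum>r=0..a+b. A r) - (\<Sum>r=0..a+b. C r)"
    unfolding sum_subtractf[symmetric]
    by (intro sum.cong refl) (simp add: S_def A_def C_def K m_def l_def, simp add: mult_ac)
  \<comment> \<open>The lower limits come from vanishing binomial coefficients:
    \<open>2 * r < 2 * a - 1\<close> for \<open>r < a\<close>, and \<open>2 * r < 2 * b + 1\<close>
    for \<open>r \<le> b\<close> in the sum of \<open>C\<close>.\<close>
  also have "(\<Sum>r=0..a+b. A r) = (\<Sum>r=a..a+b. A r)"
    by (intro sum.mono_neutral_right) (auto simp: A_def)
  also have "(\<Sum>r=0..a+b. C r) = (\<Sum>r=b+1..a+b. C r)"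
    by (intro sum.mono_neutral_right) (auto simp: C_def)
  finally have even: "(\<Sum>r=0..a+b. S (2 * r)) = (\<Sum>r=a..a+b. A r) - (\<Sum>r=b+1..a+b. C r)" .
  have "(\<Sum>r=1..a+b. S (2 * r - 1)) = (\<Sum>r=1..a+b. B r)"
  proof (intro sum.cong refl)
    fix r assume "r \<in> {1..a+b}"
    hence r: "r \<ge> 1" by simp
    hence "odd (2 * r - 1)" "2 * r - 1 + 1 = 2 * r" by simp_all
    thus "S (2 * r - 1) = B r"
      unfolding S_def B_def K(2)[OF r, symmetric] m_def by (simp add: mult_ac)
  qed
  also have "\<dots> = (\<Sum>r=a..a+b. B r)"
    using assms(1) by (intro sum.mono_neutral_right) (auto simp: B_def)
  finally show ?thesis
    unfolding sigma even A_def B_def C_def by simp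
qed

end
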